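(* Let $q=4$, $e>2$ an integer, and $n=3q^0+2q^2+2q^e$. Then, as polynomials, $g_{n,q}=x+(x+x^q)^2\,\mathrm{Tr}_{q^e/q}(x)^2$. Assume $\gcd(1+x+x^3,\ x^e+1)=1$ in $\mathbb{F}_2[x]$. Then $g_{n,q}$ is a permutation polynomial of $\mathbb{F}_{q^e}$.
   Context: For a prime $p$, a power $q$ of $p$ and an integer $n\ge 0$, $g_{n,q}\in\mathbb{F}_p[x]$ is the unique polynomial with $\sum_{a\in\mathbb{F}_q}(x+a)^n=g_{n,q}(x^q-x)$. A permutation polynomial of a finite field $\mathbb{F}$ is a polynomial inducing a bijection of $\mathbb{F}$. $\mathrm{Tr}_{q^e/q}(x)=x+x^q+\cdots+x^{q^{e-1}}$, regarded as a polynomial. *)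

theory Defs
  imports
    "Berlekamp_Zassenhaus.Finite_Field"
    "HOL-Library.Numeral_Type"
    "HOL-Computational_Algebra.Polynomial_Factorial"
begin

text \<open>
  The prime field of order \<open>p\<close> is \<^typ>\<open>'p::prime_card mod_ring\<close> with \<open>p = CARD('p)\<close>;
  in particular \<open>2 mod_ring\<close> is the field with two elements. The field of order \<open>q\<close> is any
  type \<open>'k\<close> of classes \<open>finite\<close> and \<open>field\<close> with \<open>CARD('k) = q\<close>.
\<close>

instance bit0 :: (CARD_1) prime_card
  by standard (simp add: CARD_1)

text \<open>
  Change of coefficients along the inclusion of the prime field into \<open>'k\<close>. It is a ring
  homomorphism only if \<open>'k\<close> has characteristic \<open>CARD('p)\<close>; it is used only in that case.
\<close>

definition lift_prime_poly :: "'p::prime_card mod_ring poly \<Rightarrow> 'k::field poly" where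
  "lift_prime_poly = map_poly (\<lambda>c. of_int (to_int_mod_ring c))"

text \<open>
  The polynomial \<open>g\<^sub>n\<^sub>,\<^sub>q\<close> over the prime field, where \<open>q = CARD('k)\<close>. The defining identity
  \<open>(\<Sum>a. (x + a)\<^sup>n) = g (x\<^sup>q - x)\<close> is an identity of polynomials over \<open>'k\<close>.
\<close>

definition g_poly :: "'k::{finite,field} itself \<Rightarrow> nat \<Rightarrow> 'p::prime_card mod_ring poly" where
  "g_poly _ n = (THE g.
     (\<Sum>a\<in>(UNIV :: 'k set). [:a, 1:] ^ n)
       = pcompose (lift_prime_poly g) (monom 1 CARD('k) - monom 1 1))"

definition permutation_poly :: "'f::{finite,field} poly \<Rightarrow> bool" where
  "permutation_poly f \<longleftrightarrow> bij (poly f)"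

text \<open>The trace from the field of order \<open>q\<^sup>e\<close> to the field of order \<open>q\<close>, as a polynomial.\<close>

definition trace_poly :: "nat \<Rightarrow> nat \<Rightarrow> 'a::comm_ring_1 poly" where
  "trace_poly q e = (\<Sum>i<e. monom 1 (q ^ i))"

end

theory Submission
  imports Defs
begin

text \<open>
  For \<open>a\<close> in the field with four elements, \<open>z = x + a\<close> satisfies \<open>z\<^sup>4 = z + y\<close> with
  \<open>y = x\<^sup>4 - x\<close>, so modulo this relation \<open>z\<^sup>n\<close> is a polynomial of degree three in \<open>z\<close> whose
  coefficients do not depend on \<open>a\<close>. Summing over \<open>a\<close> kills \<open>1\<close>, \<open>z\<close> and \<open>z\<^sup>2\<close> and sends
  \<open>z\<^sup>3\<close> to \<open>1\<close>.

  On the field with \<open>4\<^sup>e\<close> elements \<open>g\<close> preserves the trace. If two points with the same image have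
  the common trace \<open>t\<close>, their difference \<open>d\<close> is therefore zero or equal to \<open>t w\<close> with
  \<open>w = w\<^sup>2 + w\<^sup>8\<close>. Frobenius then acts on \<open>w\<close> with order dividing \<open>7\<close>, because \<open>1 + x + x\<^sup>3\<close>
  divides \<open>x\<^sup>7 + 1\<close>, and with order dividing \<open>2 e\<close>. The gcd condition implies that \<open>7\<close> does not
  divide \<open>e\<close>, so \<open>w\<close> is fixed by Frobenius and \<open>w = w + w = 0\<close>.
\<close>

section \<open>Finite fields of characteristic two\<close>

text \<open>Multiplication by a nonzero \<open>a\<close> permutes the nonzero elements, so it leaves
  their product unchanged.\<close>

lemma finite_field_fermat:
  fixes a :: "'a::{finite,field}"
  shows "a ^ CARD('a) = a"
proof (cases "a = 0")
  case False
  let ?U = "UNIV - {0} :: 'a set"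
  have "bij_betw ((*) a) ?U ?U"
    using False by (intro bij_betw_byWitness[where f' = "\<lambda>b. b / a"]) auto
  then have "(\<Prod>b\<in>?U. b) = (\<Prod>b\<in>?U. a * b)"
    using prod.reindex_bij_betw[of "(*) a" ?U ?U "\<lambda>b. b"] by simp
  also have "\<dots> = a ^ (CARD('a) - 1) * (\<Prod>b\<in>?U. b)"
    by (simp add: prod.distrib card_Diff_singleton)
  finally have "a ^ (CARD('a) - 1) = 1"
    by simp
  moreover have "a ^ CARD('a) = a * a ^ (CARD('a) - 1)"
    by (metis Suc_diff_1 finite_UNIV_card_ge_0 finite power_Suc)
  ultimately show ?thesis
    by simp
qed (simp add: power_0_left)

lemma CHAR_eq_if_CARD_prime_power:
  assumes "prime p" "CARD('a::{finite,field}) = p ^ m"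
  shows "CHAR('a) = p"
proof -
  have "prime CHAR('a)"
    using prime_CHAR_semidom[where ?'a = 'a] finite_imp_CHAR_pos[where ?'a = 'a] by simp
  moreover have "CHAR('a) dvd p ^ m"
    using CHAR_dvd_CARD[where ?'a = 'a] assms(2) by simp
  ultimately show ?thesis
    using assms(1) prime_dvd_power primes_dvd_imp_eq by blast
qed

lemma add_self_CHAR_2:
  assumes "CHAR('a::comm_ring_1) = 2"
  shows "(a::'a) + a = 0"
  using of_nat_CHAR[where ?'a = 'a] assms by (simp add: mult_2[symmetric])

lemma add_power2_CHAR_2:
  assumes "CHAR('a::comm_ring_1) = 2"
  shows "(a + b :: 'a) ^ 2 = a ^ 2 + b ^ 2"
  using freshmans_dream[OF _ assms[symmetric], of a b] assms by simp

lemma add_power_4_power_CHAR_2: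
  assumes "CHAR('a::comm_ring_1) = 2"
  shows "(a + b :: 'a) ^ (4 ^ i) = a ^ (4 ^ i) + b ^ (4 ^ i)"
  using freshmans_dream'[of "4 ^ i" "2 * i" a b] assms by (simp add: power_mult)

lemma sum_power_2_power_CHAR_2:
  assumes "CHAR('a::comm_ring_1) = 2"
  shows "(\<Sum>i\<in>A. f i :: 'a) ^ (2 ^ k) = (\<Sum>i\<in>A. f i ^ (2 ^ k))"
  using freshmans_dream_sum'[of "2 ^ k" k f A] assms by simp

lemma power_power_fixed:
  fixes a :: "'a::monoid_mult"
  assumes "a ^ m = a"
  shows "a ^ (m ^ k) = a"
  using assms by (induction k) (simp_all add: power_mult)

section \<open>Lifting from the prime field\<close>

text \<open>Sums and products of representatives are reduced modulo \<open>CARD('p)\<close>, a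
  reduction that \<open>of_int\<close> does not see in this characteristic.\<close>

lemma inj_idom_hom_of_int_to_int_mod_ring:
  assumes "CHAR('k::field) = CARD('p::prime_card)"
  shows "inj_idom_hom (\<lambda>c :: 'p mod_ring. of_int (to_int_mod_ring c) :: 'k)"
proof
  fix c d :: "'p mod_ring"
  show "of_int (to_int_mod_ring (c + d)) = (of_int (to_int_mod_ring c) + of_int (to_int_mod_ring d) :: 'k)"
    unfolding to_int_mod_ring_add assms[symmetric] by simp
  show "of_int (to_int_mod_ring (c * d)) = (of_int (to_int_mod_ring c) * of_int (to_int_mod_ring d) :: 'k)"
    unfolding to_int_mod_ring_mult assms[symmetric] by simp
  assume "of_int (to_int_mod_ring c) = (0 :: 'k)"
  then have "of_int_mod_ring (to_int_mod_ring c) = (0 :: 'p mod_ring)"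
    using assms by (simp add: of_int_eq_0_iff_char_dvd flip: of_int_of_int_mod_ring)
  then show "c = 0"
    by simp
qed auto

lemma inj_idom_hom_lift_prime_poly:
  assumes "CHAR('k::field) = CARD('p::prime_card)"
  shows "inj_idom_hom (lift_prime_poly :: 'p mod_ring poly \<Rightarrow> 'k poly)"
proof -
  interpret base: inj_idom_hom "\<lambda>c :: 'p mod_ring. of_int (to_int_mod_ring c) :: 'k"
    by (rule inj_idom_hom_of_int_to_int_mod_ring[OF assms])
  interpret map_poly_inj_idom_hom "\<lambda>c :: 'p mod_ring. of_int (to_int_mod_ring c) :: 'k" ..
  show ?thesis
    unfolding lift_prime_poly_def by unfold_locales
qed

lemma lift_prime_poly_monom_1:
  "lift_prime_poly (monom 1 i :: 'p::prime_card mod_ring poly) = (monom 1 i :: 'k::field poly)"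
  by (simp add: lift_prime_poly_def map_poly_monom)

lemma pcompose_monom_1: "pcompose (monom 1 i) p = p ^ i" for p :: "'a::comm_ring_1 poly"
  by (induction i) (simp_all add: monom_Suc pcompose_pCons pcompose_1)

text \<open>Discharges the uniqueness behind \<open>THE\<close>: composition with a nonconstant
  polynomial is injective, and so is the lift.\<close>

lemma g_poly_eqI:
  fixes g :: "'p::prime_card mod_ring poly"
  assumes "CHAR('k::{finite,field}) = CARD('p)"
    and "(\<Sum>a\<in>(UNIV :: 'k set). [:a, 1:] ^ n) =
      pcompose (lift_prime_poly g) (monom 1 CARD('k) - monom 1 1)"
  shows "g_poly TYPE('k) n = g"
  unfolding g_poly_def
proof (rule the1_equality[OF ex_ex1I])
  let ?Y = "monom 1 CARD('k) - monom 1 1 :: 'k poly"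
  interpret lift: inj_idom_hom "lift_prime_poly :: 'p mod_ring poly \<Rightarrow> 'k poly"
    by (rule inj_idom_hom_lift_prime_poly[OF assms(1)])
  have "CARD('k) \<noteq> 1"
    using card_1_singletonE[of "UNIV :: 'k set"] by (metis UNIV_I singletonD zero_neq_one)
  then have "CARD('k) > 1"
    by (metis One_nat_def Suc_lessI finite finite_UNIV_card_ge_0)
  \<comment> \<open>The order of the field exceeds 1, so the two monomials of \<open>?Y\<close> do
    not cancel.\<close>
  then have "coeff ?Y CARD('k) \<noteq> 0"
    by simp
  then have deg: "degree ?Y > 0"
    using \<open>CARD('k) > 1\<close> le_degree by fastforce
  fix h h' :: "'p mod_ring poly"
  assume "(\<Sum>a\<in>(UNIV :: 'k set). [:a, 1:] ^ n) = pcompose (lift_prime_poly h) ?Y"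
    and "(\<Sum>a\<in>(UNIV :: 'k set). [:a, 1:] ^ n) = pcompose (lift_prime_poly h') ?Y"
  then have "pcompose (lift_prime_poly h - lift_prime_poly h') ?Y = 0"
    by (simp add: pcompose_diff)
  then have "lift_prime_poly h = (lift_prime_poly h' :: 'k poly)"
    using pcompose_eq_0[OF _ deg] by force
  then show "h = h'"
    by simp
qed (use assms(2) in auto)

section \<open>The polynomial over the field with four elements\<close>

lemma sum_powers_CARD_4:
  assumes "CARD('k::{finite,field}) = 4"
  shows "(\<Sum>a\<in>(UNIV :: 'k set). a) = 0"
    and "(\<Sum>a\<in>(UNIV :: 'k set). a ^ 2) = 0"
    and "(\<Sum>a\<in>(UNIV :: 'k set). a ^ 3) = 1"
proof -
  have char: "CHAR('k) = 2"
    using CHAR_eq_if_CARD_prime_power[where ?'a = 'k, of 2 2] assms by simp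
  have "UNIV \<noteq> {0, 1 :: 'k}"
  proof
    assume "UNIV = {0, 1 :: 'k}"
    then have "CARD('k) = card {0, 1 :: 'k}"
      by (rule arg_cong)
    then show False
      using assms by simp
  qed
  then obtain c :: 'k where c: "c \<noteq> 0" "c \<noteq> 1"
    by blast
  \<comment> \<open>Scaling by \<open>c\<close> permutes the field, so the sum S satisfies S = c S;
    since c differs from 1, S vanishes.\<close>
  have "bij_betw ((*) c) UNIV UNIV"
    using c by (intro bij_betw_byWitness[where f' = "\<lambda>b. b / c"]) auto
  then have "(\<Sum>a\<in>(UNIV :: 'k set). a) = (\<Sum>a\<in>UNIV. c * a)"
    using sum.reindex_bij_betw[of "(*) c" UNIV UNIV "\<lambda>b. b"] by simp
  also have "\<dots> = c * (\<Sum>a\<in>UNIV. a)"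
    by (simp add: sum_distrib_left)
  finally show sum1: "(\<Sum>a\<in>(UNIV :: 'k set). a) = 0"
    using c by simp
  show "(\<Sum>a\<in>(UNIV :: 'k set). a ^ 2) = 0"
    using sum_power_2_power_CHAR_2[OF char, of "\<lambda>a. a" UNIV 1] sum1 by simp
  have "a ^ 3 = 1" if "a \<noteq> 0" for a :: 'k
  proof -
    have "a * a ^ 3 = a * 1"
      using finite_field_fermat[of a] assms by (simp add: power_Suc[symmetric])
    then show ?thesis
      using that by simp
  qed
  then have "(\<Sum>a\<in>(UNIV - {0} :: 'k set). a ^ 3) = of_nat (CARD('k) - 1)"
    by (simp add: card_Diff_singleton)
  also have "\<dots> = 1"
    using assms add_self_CHAR_2[OF char, of 1] by (simp add: numeral_3_eq_3)
  finally show "(\<Sum>a\<in>(UNIV :: 'k set). a ^ 3) = 1"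
    by (simp add: sum.remove[of UNIV "0 :: 'k"])
qed

text \<open>In the expansion of the powers of X + a, pure powers of X are summed four times and
  vanish; the mixed terms carry the power sums of orders 1 and 2, which also vanish.\<close>

lemma sum_linear_powers_CARD_4:
  assumes "CARD('k::{finite,field}) = 4"
  shows "(\<Sum>a\<in>(UNIV :: 'k set). [:a, 1:]) = 0"
    and "(\<Sum>a\<in>(UNIV :: 'k set). [:a, 1:] ^ 2) = 0"
    and "(\<Sum>a\<in>(UNIV :: 'k set). [:a, 1:] ^ 3) = 1"
proof -
  have char: "CHAR('k poly) = 2"
    using CHAR_eq_if_CARD_prime_power[where ?'a = 'k, of 2 2] assms by simp
  have const: "(\<Sum>a\<in>UNIV. [:f a:]) = [:\<Sum>a\<in>UNIV. f a:]" for f :: "'k \<Rightarrow> 'k"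
  proof -
    have "(\<Sum>a\<in>A. [:f a:]) = [:\<Sum>a\<in>A. f a:]" for A
      by (induction A rule: infinite_finite_induct) auto
    then show ?thesis .
  qed
  define X where "X = ([:0, 1:] :: 'k poly)"
  have lin: "[:a, 1:] = X + [:a:]" for a :: 'k
    by (simp add: X_def)
  have card0: "of_nat CARD('k) * r = 0" for r :: "'k poly"
    using assms add_self_CHAR_2[OF char, of "2 * r"] by simp
  show sum1: "(\<Sum>a\<in>(UNIV :: 'k set). [:a, 1:]) = 0"
    unfolding lin sum.distrib const sum_powers_CARD_4[OF assms] by (simp only: sum_constant card0) simp
  show "(\<Sum>a\<in>(UNIV :: 'k set). [:a, 1:] ^ 2) = 0"
    using sum_power_2_power_CHAR_2[OF char, of "\<lambda>a. [:a, 1:]" UNIV 1] sum1 by simp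
  have "[:a, 1:] ^ 3 = X ^ 3 + 3 * X ^ 2 * [:a:] + 3 * X * [:a ^ 2:] + [:a ^ 3:]" for a :: 'k
  proof -
    have cube: "(r + s) ^ 3 = r ^ 3 + 3 * r ^ 2 * s + 3 * r * s ^ 2 + s ^ 3" for r s :: "'k poly"
      by (simp add: algebra_simps power2_eq_square power3_eq_cube)
    show ?thesis
      unfolding lin cube by (simp only: poly_const_pow)
  qed
  then show "(\<Sum>a\<in>(UNIV :: 'k set). [:a, 1:] ^ 3) = 1"
    by (simp only: sum.distrib sum_distrib_left[symmetric] const sum_powers_CARD_4[OF assms]
        sum_constant card0) simp
qed

text \<open>Iterates z^4 = z + Y; the fourth power is additive in characteristic two, so each round
  adds one more conjugate of \<open>Y\<close>.\<close>

lemma power_4_power_linear_poly: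
  fixes a :: "'k::{finite,field}"
  assumes "CARD('k) = 4"
  defines "Y \<equiv> monom 1 4 - monom 1 1 :: 'k poly"
  shows "[:a, 1:] ^ (4 ^ i) = [:a, 1:] + (\<Sum>j<i. Y ^ (4 ^ j))"
proof (induction i)
  case (Suc i)
  have char: "CHAR('k poly) = 2"
    using CHAR_eq_if_CARD_prime_power[where ?'a = 'k, of 2 2] assms by simp
  have lin: "[:a, 1:] = monom 1 1 + [:a:]"
    unfolding x_as_monom[symmetric] by simp
  have "[:a, 1:] ^ 4 = monom 1 1 ^ 4 + [:a:] ^ 4"
    unfolding lin using add_power_4_power_CHAR_2[OF char, of "monom 1 1" "[:a:]" 1] by simp
  also have "\<dots> = monom 1 4 + [:a:]"
    using finite_field_fermat[of a] assms(1) unfolding x_pow_n poly_const_pow by simp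
  also have "\<dots> = [:a, 1:] + Y"
    unfolding lin Y_def by simp
  finally have step: "[:a, 1:] ^ 4 = [:a, 1:] + Y" .
  have "[:a, 1:] ^ (4 ^ Suc i) = ([:a, 1:] + (\<Sum>j<i. Y ^ (4 ^ j))) ^ 4"
    by (simp add: Suc.IH[symmetric] power_mult[symmetric] mult.commute)
  also have "\<dots> = [:a, 1:] ^ 4 + (\<Sum>j<i. Y ^ (4 ^ j)) ^ 4"
    using add_power_4_power_CHAR_2[OF char, of "[:a, 1:]" _ 1] by simp
  also have "(\<Sum>j<i. Y ^ (4 ^ j)) ^ 4 = (\<Sum>j<i. Y ^ (4 ^ Suc j))"
    using sum_power_2_power_CHAR_2[OF char, of _ "{..<i}" 2]
    by (simp add: power_mult[symmetric] mult.commute)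
  finally show ?case
    unfolding step sum.lessThan_Suc_shift by (simp add: add.assoc)
qed simp

lemma g_poly_CARD_4:
  assumes "CARD('k::{finite,field}) = 4"
  shows "g_poly TYPE('k) (3 + 2 * 4 ^ 2 + 2 * 4 ^ e) =
    (monom 1 1 + monom 1 1 ^ 4) ^ 2 * trace_poly 4 e ^ 2 + (monom 1 1 :: 2 mod_ring poly)"
proof (rule g_poly_eqI)
  show charp: "CHAR('k) = CARD(2)"
    using CHAR_eq_if_CARD_prime_power[where ?'a = 'k, of 2 2] assms by simp
  then have char: "CHAR('k poly) = 2"
    by simp
  interpret lift: inj_idom_hom "lift_prime_poly :: 2 mod_ring poly \<Rightarrow> 'k poly"
    by (rule inj_idom_hom_lift_prime_poly[OF charp])
  define Y where "Y = (monom 1 4 - monom 1 1 :: 'k poly)"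
  define A where "A = Y + Y ^ 4"
  define T where "T = (\<Sum>j<e. Y ^ (4 ^ j))"
  have frob: "[:a, 1:] ^ (4 ^ i) = [:a, 1:] + (\<Sum>j<i. Y ^ (4 ^ j))" for a :: 'k and i
    unfolding Y_def by (rule power_4_power_linear_poly[OF assms])
  \<comment> \<open>Only the coefficient \<open>Y + A ^ 2 * T ^ 2\<close> of the cube survives the
    summation over \<open>a\<close>.\<close>
  have expand: "[:a, 1:] ^ (3 + 2 * 4 ^ 2 + 2 * 4 ^ e) =
    [:a, 1:] + Y + Y * [:a, 1:] ^ 3 + (A ^ 2 + T ^ 2) * ([:a, 1:] ^ 2 + Y * [:a, 1:])
      + A ^ 2 * T ^ 2 * [:a, 1:] ^ 3" for a :: 'k
  proof -
    define z where "z = [:a, 1:]"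
    have z4: "z ^ 4 = z + Y" and z16: "z ^ (4 ^ 2) = z + A" and ze: "z ^ (4 ^ e) = z + T"
      unfolding z_def A_def T_def frob
      using frob[of a 1] frob[of a 2] by (simp_all add: numeral_2_eq_2)
    have "z ^ (3 + 2 * 4 ^ 2 + 2 * 4 ^ e) = z ^ 3 * (z ^ (4 ^ 2)) ^ 2 * (z ^ (4 ^ e)) ^ 2"
      unfolding power_add power_mult by (simp only: power_mult[symmetric] mult.commute[of 2])
    also have "\<dots> = z ^ 3 * (z ^ 2 + A ^ 2) * (z ^ 2 + T ^ 2)"
      unfolding z16 ze add_power2_CHAR_2[OF char] ..
    also have "\<dots> = z ^ 3 * z ^ 4 + (A ^ 2 + T ^ 2) * (z * z ^ 4) + A ^ 2 * T ^ 2 * z ^ 3"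
      by (simp add: algebra_simps eval_nat_numeral)
    also have "z ^ 3 * z ^ 4 = z ^ 4 + Y * z ^ 3"
      by (subst z4) (simp add: algebra_simps eval_nat_numeral)
    also have "z * z ^ 4 = z ^ 2 + Y * z"
      by (subst z4) (simp add: algebra_simps eval_nat_numeral)
    finally show ?thesis
      unfolding z4 unfolding z_def .
  qed
  have "(\<Sum>a\<in>(UNIV :: 'k set). Y) = 0"
    using assms add_self_CHAR_2[OF char, of "2 * Y"] by simp
  then have "(\<Sum>a\<in>(UNIV :: 'k set). [:a, 1:] ^ (3 + 2 * 4 ^ 2 + 2 * 4 ^ e)) = Y + A ^ 2 * T ^ 2"
    unfolding expand sum.distrib sum_distrib_left[symmetric] sum_linear_powers_CARD_4[OF assms]
    by simp
  \<comment> \<open>Substituting \<open>Y\<close> for x turns x + x^4 into \<open>A\<close> and the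
    trace polynomial into \<open>T\<close>.\<close>
  also have "\<dots> = pcompose (lift_prime_poly
      ((monom 1 1 + monom 1 1 ^ 4) ^ 2 * trace_poly 4 e ^ 2 + (monom 1 1 :: 2 mod_ring poly))) Y"
    unfolding A_def T_def
    by (simp add: lift.hom_add lift.hom_mult lift.hom_power lift.hom_sum trace_poly_def
        lift_prime_poly_monom_1 pcompose_hom.hom_add pcompose_hom.hom_mult
        pcompose_hom.hom_power pcompose_sum pcompose_monom_1)
  finally show "(\<Sum>a\<in>(UNIV :: 'k set). [:a, 1:] ^ (3 + 2 * 4 ^ 2 + 2 * 4 ^ e)) =
      pcompose (lift_prime_poly
      ((monom 1 1 + monom 1 1 ^ 4) ^ 2 * trace_poly 4 e ^ 2 + (monom 1 1 :: 2 mod_ring poly)))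
        (monom 1 CARD('k) - monom 1 1)"
    unfolding Y_def assms .
qed

section \<open>Permutation property\<close>

text \<open>If 7 divided \<open>e\<close>, the cubic would divide x^7 - 1, hence x^e - 1, and would
  be a common factor of positive degree.\<close>

lemma not_7_dvd_if_coprime:
  assumes "gcd (1 + monom 1 1 + monom 1 1 ^ 3) (monom 1 1 ^ e + 1 :: 2 mod_ring poly) = 1"
  shows "\<not> 7 dvd e"
proof
  define x where "x = (monom 1 1 :: 2 mod_ring poly)"
  assume "7 dvd e"
  then obtain k where k: "e = 7 * k" ..
  have char: "CHAR(2 mod_ring poly) = 2"
    by simp
  have neg: "- a = a" for a :: "2 mod_ring poly"
    using add_self_CHAR_2[OF char, of a] by (simp add: neg_eq_iff_add_eq_0)
  have two: "2 * a = 0" for a :: "2 mod_ring poly"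
    using add_self_CHAR_2[OF char, of a] by (simp only: mult_2)
  \<comment> \<open>The cofactor is (1 + x)(1 + x^2 + x^3) modulo 2; the identity holds over the
    integers, with the even part collected at the end.\<close>
  have "(1 + x + x ^ 3) * (1 + x + x ^ 2 + x ^ 4) = x ^ 7 + 1 + 2 * (x + x ^ 2 + x ^ 3 + x ^ 4 + x ^ 5)"
    by (simp add: algebra_simps eval_nat_numeral)
  then have "1 + x + x ^ 3 dvd x ^ 7 + 1"
    unfolding two by (metis add.right_neutral dvd_triv_left)
  also have "x ^ 7 + 1 = x ^ 7 - 1"
    using neg[of 1] by (metis diff_conv_add_uminus)
  also have "x ^ 7 - 1 dvd (x ^ 7) ^ k - 1"
    unfolding power_diff_1_eq by simp
  also have "(x ^ 7) ^ k - 1 = x ^ e + 1"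
    unfolding k power_mult using neg[of 1] by (metis diff_conv_add_uminus)
  finally have "1 + x + x ^ 3 dvd gcd (1 + x + x ^ 3) (x ^ e + 1)"
    by simp
  then have "is_unit (1 + x + x ^ 3)"
    unfolding assms[folded x_def] .
  moreover have "coeff (1 + x + x ^ 3) 3 = 1"
    unfolding x_def x_pow_n by (simp add: coeff_eq_0 one_pCons)
  ultimately show False
    using le_degree[of "1 + x + x ^ 3" 3] poly_dvd_1[of "1 + x + x ^ 3"] by simp
qed

lemma linearized_trinomial_kernel:
  fixes w :: "'f::field"
  assumes char: "CHAR('f) = 2" and w: "w = w ^ 2 + w ^ 8"
    and fix_e: "w ^ (4 ^ e) = w" and e: "\<not> 7 dvd e"
  shows "w = 0"
proof -
  note sq = add_power2_CHAR_2[OF char] and dbl = add_self_CHAR_2[OF char]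
  have w8: "w ^ 8 = w + w ^ 2"
    using w dbl[of "w ^ 2"] by (metis add.left_neutral add.assoc add.commute)
  \<comment> \<open>Four successive squarings of \<open>w8\<close> lead to w^128, where the relation
    for \<open>w\<close> closes the cycle.\<close>
  have "w ^ 16 = w ^ 2 + w ^ 4"
    using arg_cong[OF w8, of "\<lambda>u. u ^ 2"] sq[of w "w ^ 2"] by simp
  then have "w ^ 32 = w ^ 4 + w ^ 8"
    using sq[of "w ^ 2" "w ^ 4"] power_mult[of w 16 2] by simp
  then have "w ^ 64 = w ^ 8 + w ^ 16"
    using sq[of "w ^ 4" "w ^ 8"] power_mult[of w 32 2] by simp
  then have "w ^ 128 = w ^ 16 + w ^ 32"
    using sq[of "w ^ 8" "w ^ 16"] power_mult[of w 64 2] by simp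
  then have "w ^ 128 = (w ^ 2 + w ^ 8) + (w ^ 4 + w ^ 4)"
    unfolding \<open>w ^ 32 = _\<close> \<open>w ^ 16 = _\<close> by (simp add: ac_simps)
  then have w128: "w ^ 128 = w"
    unfolding dbl using w by simp
  have "coprime (7 :: nat) (2 * e)"
    using e by (intro prime_imp_coprime) (auto simp: prime_dvd_mult_iff dest: dvd_imp_le)
  \<comment> \<open>Squaring 7k times fixes \<open>w\<close>, and so does squaring 2el times; the
    one remaining squaring must fix it too.\<close>
  then obtain k l where kl: "7 * k = 2 * e * l + 1"
    using bezout_nat[of 7 "2 * e"] by auto
  have "128 ^ k = (4 ^ e) ^ l * (2 :: nat)"
    using arg_cong[OF kl, of "\<lambda>i. 2 ^ i :: nat"] by (simp add: power_add power_mult)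
  then have "w ^ (128 ^ k) = w ^ 2"
    by (simp add: power_mult power_power_fixed[OF fix_e])
  then have "w ^ 2 = w"
    using power_power_fixed[OF w128, of k] by simp
  moreover from this have "w ^ 8 = w"
    using power_power_fixed[of w 2 3] by simp
  ultimately show ?thesis
    using w dbl[of w] by simp
qed

lemma inj_add_trace_term:
  assumes char: "CHAR('f::field) = 2" and fixed: "\<And>v :: 'f. v ^ (4 ^ e) = v"
    and e: "\<not> 7 dvd e"
  shows "inj (\<lambda>v :: 'f. (v + v ^ 4) ^ 2 * (\<Sum>i<e. v ^ (4 ^ i)) ^ 2 + v)"
proof (rule injI)
  define tr where "tr v = (\<Sum>i<e. v ^ (4 ^ i))" for v :: 'f
  define h where "h v = (v + v ^ 4) ^ 2" for v :: 'f
  note sq = add_power2_CHAR_2[OF char] and dbl = add_self_CHAR_2[OF char]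
  have pow4: "(u + v) ^ 4 = u ^ 4 + v ^ 4" for u v :: 'f
    using add_power_4_power_CHAR_2[OF char, of u v 1] by simp
  have tr_add: "tr (u + v) = tr u + tr v" for u v
    by (simp add: tr_def add_power_4_power_CHAR_2[OF char] sum.distrib)
  have tr_pow4: "tr (v ^ 4) = tr v" for v
  proof -
    \<comment> \<open>The longer sum begins with \<open>v\<close> and ends with v^(4^e), which is
      again \<open>v\<close>; removing either end gives the two traces.\<close>
    have "tr (v ^ 4) + v = (\<Sum>i<Suc e. v ^ (4 ^ i))"
      unfolding tr_def sum.lessThan_Suc_shift by (simp add: power_mult[symmetric])
    also have "\<dots> = tr v + v"
      by (simp add: tr_def fixed)
    finally show ?thesis
      by simp
  qed
  have tr_power: "tr (v ^ (2 ^ k)) = tr v ^ (2 ^ k)" for v k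
    unfolding tr_def sum_power_2_power_CHAR_2[OF char]
    by (simp add: power_mult[symmetric] mult.commute)
  have tr4: "tr v ^ 4 = tr v" for v
    using tr_power[of v 2] tr_pow4[of v] by simp
  have tr_scale: "tr (c * v) = c * tr v" if "c ^ 4 = c" for c v
    by (simp add: tr_def power_mult_distrib power_power_fixed[OF that] sum_distrib_left)
  have h_add: "h (u + v) = h u + h v" for u v
    by (simp add: h_def pow4 sq[symmetric] ac_simps)
  have tr_h: "tr (h v) = 0" for v
    using tr_power[of "v + v ^ 4" 1] by (simp add: h_def tr_add tr_pow4 dbl)
  \<comment> \<open>The factor \<open>tr v ^ 2\<close> is fixed by the fourth power, so it comes out
    of the trace and multiplies \<open>tr (h v) = 0\<close>.\<close>
  have tr_f: "tr (h v * tr v ^ 2 + v) = tr v" for v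
  proof -
    have "(tr v ^ 2) ^ 4 = tr v ^ 2"
      by (metis tr4 power_mult mult.commute)
    then show ?thesis
      using tr_scale[of "tr v ^ 2" "h v"] by (simp add: tr_add tr_h mult.commute)
  qed
  fix u v :: 'f
  assume "(u + u ^ 4) ^ 2 * (\<Sum>i<e. u ^ (4 ^ i)) ^ 2 + u =
    (v + v ^ 4) ^ 2 * (\<Sum>i<e. v ^ (4 ^ i)) ^ 2 + v"
  then have eq: "h u * tr u ^ 2 + u = h v * tr v ^ 2 + v"
    unfolding h_def tr_def .
  define t where "t = tr v"
  have t: "tr u = t" "tr v = t"
    using tr_f[of u] tr_f[of v] eq by (simp_all add: t_def)
  define d where "d = u - v"
  \<comment> \<open>With the trace common to both points, the equation is additive and passes to the
    difference.\<close>
  have "h d * t ^ 2 + d = 0"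
    using eq h_add[of v d] unfolding t d_def by (simp add: algebra_simps)
  then have d: "d = t ^ 2 * h d"
    using dbl[of d] by (metis add_right_cancel mult.commute)
  have t4: "t ^ 4 = t"
    unfolding t_def by (rule tr4)
  \<comment> \<open>If \<open>t \<noteq> 0\<close> then \<open>t\<^sup>3 = 1\<close>, and rescaling \<open>d = t w\<close> removes \<open>t\<close> from the equation.\<close>
  show "u = v"
  proof (cases "t = 0")
    case True
    with d show ?thesis
      by (simp add: d_def)
  next
    case False
    define w where "w = d / t"
    have dw: "d = t * w"
      using False by (simp add: w_def)
    have t8: "t ^ 8 = t ^ 2"
      using power_mult[of t 4 2] t4 by simp
    have "t * w = t ^ 2 * ((t * w) ^ 2 + (t * w) ^ 8)"
      using d unfolding dw h_def sq by (simp add: power_mult[symmetric])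
    \<comment> \<open>As \<open>t ^ 8 = t ^ 2\<close>, both terms share the factor
      \<open>t ^ 4\<close>, which equals \<open>t\<close> and cancels against the left side.\<close>
    also have "\<dots> = t ^ 4 * (w ^ 2 + w ^ 8)"
      unfolding power_mult_distrib t8 by (simp add: algebra_simps eval_nat_numeral)
    finally have "w = w ^ 2 + w ^ 8"
      unfolding t4 using False by simp
    then have "w = 0"
      using linearized_trinomial_kernel[OF char _ fixed e] by blast
    then show ?thesis
      using dw by (simp add: d_def)
  qed
qed

theorem theorem6p10:
  fixes q e n :: nat and x g :: "2 mod_ring poly"
  assumes "q = 4" and "CARD('k::{finite,field}) = q"
    and "e > 2"
    and "n = 3 * q ^ 0 + 2 * q ^ 2 + 2 * q ^ e"
  defines "x \<equiv> monom 1 1"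
    and "g \<equiv> g_poly TYPE('k) n"
  shows "g = x + (x + x ^ q) ^ 2 * trace_poly q e ^ 2 \<and>
    (gcd (1 + x + x ^ 3) (x ^ e + 1) = 1 \<longrightarrow>
     CARD('f::{finite,field}) = q ^ e \<longrightarrow>
     permutation_poly (lift_prime_poly g :: 'f poly))"
proof (intro conjI impI)
  have n: "n = 3 + 2 * 4 ^ 2 + 2 * 4 ^ e"
    using assms by simp
  show g: "g = x + (x + x ^ q) ^ 2 * trace_poly q e ^ 2"
    using g_poly_CARD_4[where ?'k = 'k, of e] assms(1,2)
    unfolding g_def x_def n by (simp add: add.commute)
  assume coprime: "gcd (1 + x + x ^ 3) (x ^ e + 1) = 1" and card: "CARD('f) = q ^ e"
  have e: "\<not> 7 dvd e"
    using coprime unfolding x_def by (rule not_7_dvd_if_coprime)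
  have char: "CHAR('f) = 2"
    using CHAR_eq_if_CARD_prime_power[where ?'a = 'f, of 2 "2 * e"] card assms(1)
    by (simp add: power_mult)
  interpret lift: inj_idom_hom "lift_prime_poly :: 2 mod_ring poly \<Rightarrow> 'f poly"
    by (rule inj_idom_hom_lift_prime_poly) (simp add: char)
  have "poly (lift_prime_poly g :: 'f poly) =
      (\<lambda>v. (v + v ^ 4) ^ 2 * (\<Sum>i<e. v ^ (4 ^ i)) ^ 2 + v)"
    unfolding g x_def \<open>q = 4\<close>
    by (simp add: fun_eq_iff lift.hom_add lift.hom_mult lift.hom_power lift.hom_sum trace_poly_def lift_prime_poly_monom_1
        poly_monom poly_sum add.commute)
  moreover have "inj \<dots>"
    using inj_add_trace_term[OF char _ e] finite_field_fermat[where ?'a = 'f] card assms(1)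
    by simp
  ultimately show "permutation_poly (lift_prime_poly g :: 'f poly)"
    unfolding permutation_poly_def bij_def by (simp add: finite_UNIV_inj_surj)
qed

end
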